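(* Let $\{X_i\}_{i=1}^\infty$ be an i.i.d. sequence of $d$-dimensional random vectors under a sublinear expectation $\mathbb{E}=\sup_{\theta\in\Theta}E_\theta$. Suppose that the convex hull of the closure of the set of all possible means $\{E_\theta[X_1]:\theta\in\Theta\}$ is a bounded convex polytope $\mathcal{P}$ with $m$ vertices. Then $$\mathbb{E}\big[d_{\mathcal{P}}^2(\overline{X}_n)\big]\le\frac{m\big\{\sup_{\theta\in\Theta}E_\theta\big[|X_1-E_\theta[X_1]|^2\big]+\mathrm{diam}^2(\mathcal{P})\big\}}{n},$$ where $\overline{X}_n=\sum_{i=1}^nX_i/n$, $|\cdot|$ denotes the Euclidean norm, and $\mathrm{diam}(\mathcal{P})$ denotes the diameter of $\mathcal{P}$.
   Context: Let $\{P_\theta:\theta\in\Theta\}$ be a set of probability measures on a measurable space $(\Omega,\mathcal{F})$, and let $E_\theta$ be the expectation under $P_\theta$. For a random variable $X$ such that $E_\theta[X]$ exists for all $\theta\in\Theta$, the sublinear expectation is $\mathbb{E}[X]:=\sup_{\theta\in\Theta}E_\theta[X]$. Two random vectors $X,Y$ of the same dimension are identically distributed if $\mathbb{E}[\varphi(X)]=\mathbb{E}[\varphi(Y)]$ for all bounded continuous $\varphi$. A random vector $Y\in\mathbb{R}^k$ is independent of a random vector $X\in\mathbb{R}^l$ if $\mathbb{E}[\varphi(X,Y)]=\mathbb{E}\big\{\{\mathbb{E}[\varphi(x,Y)]\}_{x=X}\big\}$ for all bounded continuous $\varphi:\mathbb{R}^{l+k}\to\mathbb{R}$ (this relation is not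 symmetric). A sequence $\{X_i\}_{i=1}^\infty$ is i.i.d. if for each $i\ge1$, $X_{i+1}$ is identically distributed as $X_1$ and independent of $(X_1,\dots,X_i)$. For $A\subset\mathbb{R}^d$ and $x\in\mathbb{R}^d$, $d_A(x):=\inf_{y\in A}|y-x|$, and $d_A^2(x)=(d_A(x))^2$. *)

theory Defs
  imports "HOL-Probability.Probability"
begin

text \<open>
  Expectations take values in the extended reals, so that suprema over the family of measures and
  expectations of unbounded nonnegative random variables need no finiteness side conditions.
  The value is meaningful whenever the positive or the negative part has finite integral
  (otherwise the difference reads \<open>\<infinity> - \<infinity>\<close>).
\<close>

definition expect :: "'w measure \<Rightarrow> ('w \<Rightarrow> ereal) \<Rightarrow> ereal" where
  "expect M X =
     enn2ereal (\<integral>\<^sup>+ \<omega>. e2ennreal (X \<omega>) \<partial>M) - enn2ereal (\<integral>\<^sup>+ \<omega>. e2ennreal (- X \<omega>) \<partial>M)"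

lemma expect_nonneg:
  assumes "\<And>\<omega>. 0 \<le> X \<omega>"
  shows "expect M X = enn2ereal (\<integral>\<^sup>+ \<omega>. e2ennreal (X \<omega>) \<partial>M)"
proof -
  have "e2ennreal (- X \<omega>) = 0" for \<omega>
    using assms[of \<omega>] by (simp add: e2ennreal_neg)
  then show ?thesis by (simp add: expect_def zero_ennreal.rep_eq)
qed

lemma expect_integrable:
  fixes X :: "'w \<Rightarrow> real"
  assumes "integrable M X"
  shows "expect M (\<lambda>\<omega>. ereal (X \<omega>)) = ereal (\<integral>\<omega>. X \<omega> \<partial>M)"
proof -
  have fin: "(\<integral>\<^sup>+ \<omega>. ennreal (X \<omega>) \<partial>M) < \<infinity>" "(\<integral>\<^sup>+ \<omega>. ennreal (- X \<omega>) \<partial>M) < \<infinity>"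
    using assms by (auto simp: real_integrable_def top.not_eq_extremum)
  have *: "enn2ereal z = ereal (enn2real z)" if "z < \<infinity>" for z
    using that by (cases z) (auto simp: enn2ereal_ennreal)
  have "- ereal r = ereal (- r)" for r by simp
  then show ?thesis
    using fin by (simp add: expect_def * real_lebesgue_integral_def[OF assms]
        flip: ennreal.abs_eq)
qed

definition sublin :: "('t \<Rightarrow> 'w measure) \<Rightarrow> 't set \<Rightarrow> ('w \<Rightarrow> ereal) \<Rightarrow> ereal" where
  "sublin P \<Theta> X = (SUP \<theta>\<in>\<Theta>. expect (P \<theta>) X)"

definition sublin_ident_distr ::
    "('t \<Rightarrow> 'w measure) \<Rightarrow> 't set \<Rightarrow> ('w \<Rightarrow> 'a::euclidean_space) \<Rightarrow> ('w \<Rightarrow> 'a) \<Rightarrow> bool" where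
  "sublin_ident_distr P \<Theta> X Y \<longleftrightarrow>
     (\<forall>\<phi> :: 'a \<Rightarrow> real. continuous_on UNIV \<phi> \<and> bounded (range \<phi>) \<longrightarrow>
        sublin P \<Theta> (\<lambda>\<omega>. ereal (\<phi> (X \<omega>))) = sublin P \<Theta> (\<lambda>\<omega>. ereal (\<phi> (Y \<omega>))))"

text \<open>
  \<open>Y\<close> is independent of \<open>X\<close>; the relation is not symmetric. The space of values of \<open>X\<close> is an
  explicit topology \<open>S\<close>, since it is a finite power of a Euclidean space whose exponent
  varies along the sequence.
\<close>

definition sublin_indep ::
    "('t \<Rightarrow> 'w measure) \<Rightarrow> 't set \<Rightarrow> ('w \<Rightarrow> 'a::euclidean_space) \<Rightarrow> 'b topology \<Rightarrow> ('w \<Rightarrow> 'b) \<Rightarrow> bool"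
  where
  "sublin_indep P \<Theta> Y S X \<longleftrightarrow>
     (\<forall>\<phi> :: 'b \<times> 'a \<Rightarrow> real.
        continuous_map (prod_topology S euclidean) euclideanreal \<phi> \<and>
        bounded (\<phi> ` topspace (prod_topology S euclidean)) \<longrightarrow>
        sublin P \<Theta> (\<lambda>\<omega>. ereal (\<phi> (X \<omega>, Y \<omega>))) =
        sublin P \<Theta> (\<lambda>\<omega>. sublin P \<Theta> (\<lambda>\<omega>'. ereal (\<phi> (X \<omega>, Y \<omega>')))))"

text \<open>
  Sequences are indexed from \<open>1\<close>; \<open>X 0\<close> is irrelevant. The vector \<open>(X 1, \<dots>, X i)\<close> is the
  extensional function on \<open>{1..i}\<close>, a point of the \<open>i\<close>-fold product space.
\<close>

definition sublin_iid ::
    "('t \<Rightarrow> 'w measure) \<Rightarrow> 't set \<Rightarrow> (nat \<Rightarrow> 'w \<Rightarrow> 'a::euclidean_space) \<Rightarrow> bool" where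
  "sublin_iid P \<Theta> X \<longleftrightarrow>
     (\<forall>i\<ge>1. sublin_ident_distr P \<Theta> (X (Suc i)) (X 1) \<and>
        sublin_indep P \<Theta> (X (Suc i))
          (product_topology (\<lambda>_. euclidean) {1..i}) (\<lambda>\<omega>. \<lambda>j\<in>{1..i}. X j \<omega>))"

end

theory Submission
  imports Defs
begin

text \<open>
  With \<open>S\<^sub>k = X\<^sub>1 + \<dots> + X\<^sub>k\<close>, the squared distance of \<open>S\<^sub>k\<close> to the dilate \<open>k\<P>\<close> grows
  by at most a constant \<open>c\<close> per step. Let \<open>p\<close> be a point of \<open>k\<P>\<close> closest to \<open>s\<close> and let \<open>q\<close>
  maximize the inner product with \<open>s - p\<close> over \<open>\<P>\<close>. Then \<open>p + q\<close> lies in \<open>(k+1)\<P>\<close>, and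
  under each measure the cross term of \<open>|(s - p) + (X - q)|\<^sup>2\<close> has nonpositive expectation,
  while \<open>|X - q|\<^sup>2\<close> contributes at most \<open>c\<close>, the variance plus the squared diameter. Dividing
  by \<open>n\<^sup>2\<close> gives the bound \<open>c / n\<close>, and \<open>m \<ge> 1\<close>.
  As independence only concerns bounded test functions, the induction runs with squared distances
  truncated at a fixed level.
\<close>

section \<open>Expectations and suprema of nonnegative functions\<close>

lemma expect_ennreal:
  fixes f :: "'w \<Rightarrow> real"
  assumes "\<And>\<omega>. 0 \<le> f \<omega>"
  shows "expect M (\<lambda>\<omega>. ereal (f \<omega>)) = enn2ereal (\<integral>\<^sup>+ \<omega>. ennreal (f \<omega>) \<partial>M)"
  using assms by (simp add: expect_nonneg)

text \<open>For nonnegative functions the negative part in \<open>expect\<close> vanishes, so a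
  bound on the supremum splits into one bound on a nonnegative integral per measure. This is the
  bridge between \<open>sublin\<close> and estimates under a single
  \<open>P \<theta>\<close>.\<close>

lemma sublin_le_iff:
  fixes f :: "'w \<Rightarrow> real"
  assumes "\<And>\<omega>. 0 \<le> f \<omega>" "0 \<le> a"
  shows "sublin P \<Theta> (\<lambda>\<omega>. ereal (f \<omega>)) \<le> ereal a \<longleftrightarrow>
    (\<forall>\<theta>\<in>\<Theta>. (\<integral>\<^sup>+ \<omega>. ennreal (f \<omega>) \<partial>P \<theta>) \<le> ennreal a)"
proof -
  have "enn2ereal z \<le> ereal a \<longleftrightarrow> z \<le> ennreal a" for z
    using assms(2) by (simp add: less_eq_ennreal.rep_eq)
  then show ?thesis
    by (simp add: sublin_def SUP_le_iff expect_ennreal[OF assms(1)])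
qed

text \<open>The nonnegative integral is monotone on arbitrary functions. Measurability is left out
  on purpose: the inner sublinear expectation, as a function of \<omega>, has to be a legitimate
  argument.\<close>

lemma expect_mono:
  assumes "\<And>\<omega>. 0 \<le> f \<omega>" "\<And>\<omega>. f \<omega> \<le> g \<omega>"
  shows "expect M f \<le> expect M g"
proof -
  have "0 \<le> g \<omega>" for \<omega>
    using assms order_trans by blast
  then show ?thesis
    using assms
    by (auto simp: expect_nonneg less_eq_ennreal.rep_eq[symmetric]
        intro!: nn_integral_mono e2ennreal_mono)
qed

lemma sublin_mono:
  assumes "\<And>\<omega>. 0 \<le> f \<omega>" "\<And>\<omega>. f \<omega> \<le> g \<omega>"
  shows "sublin P \<Theta> f \<le> sublin P \<Theta> g"
  unfolding sublin_def using assms by (intro SUP_mono) (auto intro: expect_mono)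

lemma sublin_nonneg:
  assumes "\<Theta> \<noteq> {}" "\<And>\<omega>. 0 \<le> f \<omega>"
  shows "0 \<le> sublin P \<Theta> f"
proof -
  obtain \<theta> where "\<theta> \<in> \<Theta>" using assms(1) by auto
  moreover have "0 \<le> expect (P \<theta>) f"
    using assms(2) by (simp add: expect_nonneg)
  ultimately show ?thesis unfolding sublin_def by (meson SUP_upper2)
qed

section \<open>Squared distance to a dilate\<close>

definition sqdist_dilate :: "'a::euclidean_space set \<Rightarrow> nat \<Rightarrow> 'a \<Rightarrow> real" where
  "sqdist_dilate K k s = (infdist s ((*\<^sub>R) (real k) ` K))\<^sup>2"

lemma sqdist_dilate_nonneg: "0 \<le> sqdist_dilate K k s"
  by (simp add: sqdist_dilate_def)

lemma continuous_on_sqdist_dilate: "continuous_on A (sqdist_dilate K k)"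
  unfolding sqdist_dilate_def by (intro continuous_intros)

lemma borel_measurable_sqdist_dilate:
  "f \<in> borel_measurable M \<Longrightarrow> (\<lambda>x. sqdist_dilate K k (f x)) \<in> borel_measurable M"
  by (rule borel_measurable_continuous_on[OF continuous_on_sqdist_dilate])

text \<open>The dilate of a nonempty set by 0 is the origin alone; this gives the starting value of
  the induction.\<close>

lemma sqdist_dilate_0:
  assumes "K \<noteq> {}"
  shows "sqdist_dilate K 0 0 = 0"
proof -
  have "(0::'a) \<in> (*\<^sub>R) (real 0) ` K" using assms by auto
  then show ?thesis by (simp add: sqdist_dilate_def del: of_nat_0)
qed

lemma sqdist_dilate_le:
  assumes "p \<in> (*\<^sub>R) (real k) ` K"
  shows "sqdist_dilate K k s \<le> (norm (s - p))\<^sup>2"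
  using infdist_le[OF assms, of s]
  by (auto simp: sqdist_dilate_def dist_norm infdist_nonneg intro!: power_mono)

lemma sqdist_dilate_attained:
  assumes "compact K" "K \<noteq> {}"
  obtains p where "p \<in> (*\<^sub>R) (real k) ` K" "sqdist_dilate K k s = (norm (s - p))\<^sup>2"
proof -
  have "closed ((*\<^sub>R) (real k) ` K)"
    using assms(1) by (intro compact_imp_closed compact_scaling)
  then obtain p where "p \<in> (*\<^sub>R) (real k) ` K" "infdist s ((*\<^sub>R) (real k) ` K) = dist s p"
    using infdist_attains_inf[of "(*\<^sub>R) (real k) ` K" s] assms(2) by auto
  then show thesis by (intro that) (auto simp: sqdist_dilate_def dist_norm)
qed

text \<open>By convexity the weights \<open>k/(k+1)\<close> and \<open>1/(k+1)\<close> combine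
  \<open>p/k\<close> and \<open>q\<close> into a point of \<open>K\<close>. Working with a preimage
  \<open>a\<close> of \<open>p\<close> instead of \<open>p/k\<close> also covers
  \<open>k = 0\<close>.\<close>

lemma dilate_add:
  fixes K :: "'a::euclidean_space set"
  assumes "convex K" "p \<in> (*\<^sub>R) (real k) ` K" "q \<in> K"
  shows "p + q \<in> (*\<^sub>R) (real (Suc k)) ` K"
proof -
  obtain a where a: "a \<in> K" "p = real k *\<^sub>R a" using assms(2) by auto
  let ?b = "(real k / real (Suc k)) *\<^sub>R a + (1 / real (Suc k)) *\<^sub>R q"
  have "?b \<in> K"
    using assms(1,3) a(1) by (intro convexD) (auto simp: field_simps)
  moreover have "p + q = real (Suc k) *\<^sub>R ?b"
    by (simp only: a(2) scaleR_add_right scaleR_scaleR) simp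
  ultimately show ?thesis by blast
qed

text \<open>Scaling by \<open>1/n\<close> sends a closest point of the dilate to a point of
  \<open>K\<close>, which is a candidate for the distance of the mean.\<close>

lemma infdist_mean_le_dilate:
  assumes "compact K" "K \<noteq> {}" "n \<ge> 1"
  shows "(infdist (s /\<^sub>R real n) K)\<^sup>2 \<le> sqdist_dilate K n s / (real n)\<^sup>2"
proof -
  obtain p where p: "p \<in> (*\<^sub>R) (real n) ` K" "sqdist_dilate K n s = (norm (s - p))\<^sup>2"
    using sqdist_dilate_attained assms by blast
  then obtain b where b: "b \<in> K" "p = real n *\<^sub>R b" by auto
  have "s /\<^sub>R real n - b = (s - p) /\<^sub>R real n"
    using assms(3) by (simp add: b(2) scaleR_diff_right)
  then have "dist (s /\<^sub>R real n) b = norm (s - p) / real n"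
    by (simp add: dist_norm divide_inverse mult.commute)
  then have "infdist (s /\<^sub>R real n) K \<le> norm (s - p) / real n"
    using infdist_le[OF b(1)] by metis
  then have "(infdist (s /\<^sub>R real n) K)\<^sup>2 \<le> (norm (s - p) / real n)\<^sup>2"
    by (intro power_mono) (auto simp: infdist_nonneg)
  then show ?thesis by (simp add: p(2) power_divide)
qed

section \<open>One step under a single measure\<close>

text \<open>Bias-variance decomposition: expanding around the mean, the cross term integrates to
  zero.\<close>

lemma (in prob_space) nn_integral_sqnorm_shift:
  fixes X :: "'a \<Rightarrow> 'b::euclidean_space"
  assumes X: "integrable M X"
    and v: "(\<integral>\<^sup>+ \<omega>. ennreal ((norm (X \<omega> - (\<integral>\<omega>'. X \<omega>' \<partial>M)))\<^sup>2) \<partial>M) \<le> ennreal v" "0 \<le> v"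
  shows "(\<integral>\<^sup>+ \<omega>. ennreal ((norm (X \<omega> + u))\<^sup>2) \<partial>M) \<le> ennreal ((norm ((\<integral>\<omega>. X \<omega> \<partial>M) + u))\<^sup>2 + v)"
proof -
  define \<mu> where "\<mu> = (\<integral>\<omega>. X \<omega> \<partial>M)"
  have [measurable]: "X \<in> borel_measurable M" using X by simp
  \<comment> \<open>The finite bound \<open>v\<close> gives square integrability, so the expansion
    can be integrated term by term as a Bochner integral.\<close>
  have int2: "integrable M (\<lambda>\<omega>. (norm (X \<omega> - \<mu>))\<^sup>2)"
  proof (rule integrableI_bounded)
    show "(\<integral>\<^sup>+ \<omega>. ennreal (norm ((norm (X \<omega> - \<mu>))\<^sup>2)) \<partial>M) < \<infinity>"
      using v(1) by (simp add: \<mu>_def le_less_trans)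
  qed simp
  have le: "(\<integral>\<omega>. (norm (X \<omega> - \<mu>))\<^sup>2 \<partial>M) \<le> v"
    using v(1) by (simp flip: \<mu>_def add: nn_integral_eq_integral[OF int2] v(2))
  have exp: "(norm (X \<omega> + u))\<^sup>2 = (norm (\<mu> + u))\<^sup>2 + 2 * ((\<mu> + u) \<bullet> (X \<omega> - \<mu>)) + (norm (X \<omega> - \<mu>))\<^sup>2"
    for \<omega>
    by (simp add: power2_norm_eq_inner inner_simps inner_commute algebra_simps)
  have int1: "integrable M (\<lambda>\<omega>. (\<mu> + u) \<bullet> (X \<omega> - \<mu>))"
    using X by (intro integrable_inner_right) auto
  have zero: "(\<integral>\<omega>. (\<mu> + u) \<bullet> (X \<omega> - \<mu>) \<partial>M) = 0"
    using X by (subst integral_inner_right) (auto simp: \<mu>_def prob_space)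
  have int: "integrable M (\<lambda>\<omega>. (norm (X \<omega> + u))\<^sup>2)"
    unfolding exp using int1 int2 by auto
  have "(\<integral>\<omega>. (norm (X \<omega> + u))\<^sup>2 \<partial>M) = (norm (\<mu> + u))\<^sup>2 + (\<integral>\<omega>. (norm (X \<omega> - \<mu>))\<^sup>2 \<partial>M)"
    unfolding exp using int1 int2 zero by (simp add: prob_space)
  then show ?thesis
    using le by (simp add: nn_integral_eq_integral[OF int] ennreal_leI \<mu>_def del: ennreal_plus)
qed

lemma (in prob_space) nn_integral_sqdist_dilate_step:
  fixes X :: "'a \<Rightarrow> 'b::euclidean_space"
  assumes K: "compact K" "convex K" and X: "integrable M X" and mean: "(\<integral>\<omega>. X \<omega> \<partial>M) \<in> K"
    and v: "(\<integral>\<^sup>+ \<omega>. ennreal ((norm (X \<omega> - (\<integral>\<omega>'. X \<omega>' \<partial>M)))\<^sup>2) \<partial>M) \<le> ennreal v" "0 \<le> v"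
  shows "(\<integral>\<^sup>+ \<omega>. ennreal (sqdist_dilate K (Suc k) (s + X \<omega>)) \<partial>M)
    \<le> ennreal (sqdist_dilate K k s + (v + (diameter K)\<^sup>2))"
proof -
  define \<mu> where "\<mu> = (\<integral>\<omega>. X \<omega> \<partial>M)"
  have ne: "K \<noteq> {}" using mean by auto
  obtain p where p: "p \<in> (*\<^sub>R) (real k) ` K" "sqdist_dilate K k s = (norm (s - p))\<^sup>2"
    using sqdist_dilate_attained K(1) ne by blast
  have "continuous_on K (\<lambda>y. (s - p) \<bullet> y)" by (intro continuous_intros)
  \<comment> \<open>Maximality of \<open>q\<close> makes the cross term nonpositive for every mean
    in \<open>K\<close>, so \<open>q\<close> depends on \<open>s\<close> and \<open>K\<close> but
    not on the measure.\<close>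
  then obtain q where q: "q \<in> K" "\<And>y. y \<in> K \<Longrightarrow> (s - p) \<bullet> y \<le> (s - p) \<bullet> q"
    using continuous_attains_sup[OF K(1) ne] by blast
  have "norm (\<mu> - q) \<le> diameter K"
    using diameter_bounded_bound[OF compact_imp_bounded[OF K(1)], of \<mu> q] mean q(1)
    by (simp add: dist_norm \<mu>_def)
  then have "(norm (\<mu> - q))\<^sup>2 \<le> (diameter K)\<^sup>2" by (intro power_mono) auto
  moreover have "2 * ((s - p) \<bullet> \<mu> - (s - p) \<bullet> q) \<le> 0" using q(2) mean by (simp add: \<mu>_def)
  moreover have "(norm (\<mu> + (s - p - q)))\<^sup>2
      = (norm (s - p))\<^sup>2 + 2 * ((s - p) \<bullet> \<mu> - (s - p) \<bullet> q) + (norm (\<mu> - q))\<^sup>2"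
    by (simp add: power2_norm_eq_inner inner_simps inner_commute algebra_simps)
  ultimately have bnd: "(norm (\<mu> + (s - p - q)))\<^sup>2 \<le> (norm (s - p))\<^sup>2 + (diameter K)\<^sup>2"
    by simp
  have "sqdist_dilate K (Suc k) (s + x) \<le> (norm (x + (s - p - q)))\<^sup>2" for x
    using sqdist_dilate_le[OF dilate_add[OF K(2) p(1) q(1)], of "s + x"]
    by (simp add: algebra_simps)
  then have "(\<integral>\<^sup>+ \<omega>. ennreal (sqdist_dilate K (Suc k) (s + X \<omega>)) \<partial>M)
      \<le> (\<integral>\<^sup>+ \<omega>. ennreal ((norm (X \<omega> + (s - p - q)))\<^sup>2) \<partial>M)"
    by (intro nn_integral_mono ennreal_leI)
  also have "\<dots> \<le> ennreal ((norm (\<mu> + (s - p - q)))\<^sup>2 + v)"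
    unfolding \<mu>_def by (rule nn_integral_sqnorm_shift[OF X v])
  also have "\<dots> \<le> ennreal (sqdist_dilate K k s + (v + (diameter K)\<^sup>2))"
    using bnd by (intro ennreal_leI) (simp add: p(2))
  finally show ?thesis .
qed

section \<open>Truncation and additive constants\<close>

text \<open>Monotone convergence in the truncation level; it carries bounds for bounded test
  functions over to the unbounded squared distance.\<close>

lemma nn_integral_le_truncated:
  fixes f :: "'w \<Rightarrow> real"
  assumes [measurable]: "f \<in> borel_measurable M"
    and le: "\<And>N::nat. (\<integral>\<^sup>+ \<omega>. ennreal (min (real N) (f \<omega>)) \<partial>M) \<le> B"
  shows "(\<integral>\<^sup>+ \<omega>. ennreal (f \<omega>) \<partial>M) \<le> B"
proof -
  have "(SUP N. ennreal (min (real N) (f \<omega>))) = ennreal (f \<omega>)" for \<omega>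
  proof (rule antisym)
    obtain N where "f \<omega> \<le> real N" using real_arch_simple by blast
    then have "ennreal (f \<omega>) = ennreal (min (real N) (f \<omega>))" by (simp add: min_absorb2)
    then show "ennreal (f \<omega>) \<le> (SUP N. ennreal (min (real N) (f \<omega>)))"
      by (metis SUP_upper UNIV_I)
  qed (auto intro!: SUP_least ennreal_leI)
  then have "(\<integral>\<^sup>+ \<omega>. ennreal (f \<omega>) \<partial>M) = (\<integral>\<^sup>+ \<omega>. (SUP N. ennreal (min (real N) (f \<omega>))) \<partial>M)"
    by simp
  also have "\<dots> = (SUP N. \<integral>\<^sup>+ \<omega>. ennreal (min (real N) (f \<omega>)) \<partial>M)"
    by (intro nn_integral_monotone_convergence_SUP)
      (auto simp: incseq_def le_fun_def intro!: ennreal_leI)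
  also have "\<dots> \<le> B" using le by (auto intro: SUP_least)
  finally show ?thesis .
qed

text \<open>Each \<open>P \<theta>\<close> has total mass 1, so the constant contributes exactly
  \<open>c\<close> under every measure. Measurability of \<open>f\<close> enters through additivity
  of the integral.\<close>

lemma sublin_add_const_le:
  fixes f :: "'w \<Rightarrow> real"
  assumes "\<And>\<theta>. \<theta> \<in> \<Theta> \<Longrightarrow> prob_space (P \<theta>)"
    and "\<And>\<theta>. \<theta> \<in> \<Theta> \<Longrightarrow> f \<in> borel_measurable (P \<theta>)"
    and "\<And>\<omega>. 0 \<le> f \<omega>" "0 \<le> c" "0 \<le> a"
    and "sublin P \<Theta> (\<lambda>\<omega>. ereal (f \<omega>)) \<le> ereal a"
  shows "sublin P \<Theta> (\<lambda>\<omega>. ereal (f \<omega> + c)) \<le> ereal (a + c)"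
proof -
  have "(\<integral>\<^sup>+ \<omega>. ennreal (f \<omega> + c) \<partial>P \<theta>) \<le> ennreal (a + c)" if "\<theta> \<in> \<Theta>" for \<theta>
  proof -
    interpret prob_space "P \<theta>" using that assms(1) by blast
    have [measurable]: "f \<in> borel_measurable (P \<theta>)" using that assms(2) by blast
    have "(\<integral>\<^sup>+ \<omega>. ennreal (f \<omega> + c) \<partial>P \<theta>) = (\<integral>\<^sup>+ \<omega>. ennreal (f \<omega>) \<partial>P \<theta>) + ennreal c"
      using assms(3,4) by (simp add: nn_integral_add emeasure_space_1)
    also have "\<dots> \<le> ennreal a + ennreal c"
      using assms(3,5,6) that by (intro add_right_mono) (simp add: sublin_le_iff)
    finally show ?thesis using assms(4,5) by simp
  qed
  then show ?thesis using assms(3-5) by (subst sublin_le_iff) auto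
qed

section \<open>Induction along the sequence\<close>

text \<open>Independence freezes the first \<open>k\<close> vectors, identical distribution replaces
  the next one by \<open>X 1\<close>, and \<open>step\<close> then costs \<open>c\<close>. The level
  \<open>b\<close> is preserved, so the induction hypothesis applies again.\<close>

lemma sublin_truncated_sqdist_le:
  fixes X :: "nat \<Rightarrow> 'w \<Rightarrow> 'a::euclidean_space"
  assumes "\<Theta> \<noteq> {}"
    and prob: "\<And>\<theta>. \<theta> \<in> \<Theta> \<Longrightarrow> prob_space (P \<theta>)"
    and meas: "\<And>\<theta> i. \<theta> \<in> \<Theta> \<Longrightarrow> i \<ge> 1 \<Longrightarrow> X i \<in> borel_measurable (P \<theta>)"
    and iid: "sublin_iid P \<Theta> X"
    and step: "\<And>k s. sublin P \<Theta> (\<lambda>\<omega>. ereal (sqdist_dilate K (Suc k) (s + X 1 \<omega>)))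
        \<le> ereal (sqdist_dilate K k s + c)"
    and K: "K \<noteq> {}" and c: "0 \<le> c" and b: "0 \<le> b" and n: "n \<ge> 1"
  shows "sublin P \<Theta> (\<lambda>\<omega>. ereal (min b (sqdist_dilate K n (\<Sum>i=1..n. X i \<omega>)))) \<le> ereal (real n * c)"
  using n
proof (induction n rule: nat_induct_at_least)
  case base
  have "sublin P \<Theta> (\<lambda>\<omega>. ereal (min b (sqdist_dilate K 1 (X 1 \<omega>))))
      \<le> sublin P \<Theta> (\<lambda>\<omega>. ereal (sqdist_dilate K (Suc 0) (0 + X 1 \<omega>)))"
    using b by (intro sublin_mono) (auto simp: sqdist_dilate_nonneg)
  also have "\<dots> \<le> ereal c" using step[of 0 0] by (simp add: sqdist_dilate_0[OF K])
  finally show ?case by simp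
next
  case (Suc k)
  define T where "T = product_topology (\<lambda>_::nat. euclidean :: 'a topology) {1..k}"
  define V where "V = (\<lambda>\<omega>. \<lambda>j\<in>{1..k}. X j \<omega>)"
  define S where "S = (\<lambda>\<omega>. \<Sum>i=1..k. X i \<omega>)"
  \<comment> \<open>The truncated squared distance of the partial sum, written as a function of the
    pair (past, next vector) to which independence applies.\<close>
  define \<phi> where "\<phi> = (\<lambda>(y, x). min b (sqdist_dilate K (Suc k) ((\<Sum>j=1..k. y j) + x)))"
  have sumV: "(\<Sum>j=1..k. V \<omega> j) = S \<omega>" for \<omega> by (simp add: V_def S_def)
  have \<phi>_range: "0 \<le> \<phi> z" "\<phi> z \<le> b" for z
    using b by (auto simp: \<phi>_def sqdist_dilate_nonneg split: prod.split)
  have bounded: "bounded (\<phi> ` A)" for A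
    unfolding bounded_iff using \<phi>_range by (auto intro!: exI[of _ b])
  \<comment> \<open>Continuity refers to the finite product topology \<open>T\<close> on extensional
    functions, so each coordinate is handled by its projection.\<close>
  have "continuous_map (prod_topology T euclidean) euclidean
      (\<lambda>z. (\<Sum>j=1..k. fst z j) + snd z)"
  proof (intro continuous_map_add continuous_map_sum continuous_map_snd)
    fix j assume "j \<in> {1..k}"
    then have "continuous_map T euclidean (\<lambda>y. y j)"
      unfolding T_def by (rule continuous_map_product_projection)
    from continuous_map_compose[OF continuous_map_fst this]
    show "continuous_map (prod_topology T euclidean) euclidean (\<lambda>z. fst z j)"
      by (simp add: o_def)
  qed simp
  moreover have "continuous_map euclidean euclideanreal (\<lambda>s. min b (sqdist_dilate K (Suc k) s))"
    by (auto intro!: continuous_intros continuous_on_sqdist_dilate)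
  ultimately have "continuous_map (prod_topology T euclidean) euclideanreal
      ((\<lambda>s. min b (sqdist_dilate K (Suc k) s)) \<circ> (\<lambda>z. (\<Sum>j=1..k. fst z j) + snd z))"
    by (rule continuous_map_compose)
  then have cont: "continuous_map (prod_topology T euclidean) euclideanreal \<phi>"
    by (simp add: \<phi>_def o_def case_prod_unfold)
  have indep: "sublin_indep P \<Theta> (X (Suc k)) T V"
    and ident: "sublin_ident_distr P \<Theta> (X (Suc k)) (X 1)"
    using iid Suc.hyps by (auto simp: sublin_iid_def T_def V_def)
  have inner: "sublin P \<Theta> (\<lambda>\<omega>'. ereal (\<phi> (V \<omega>, X (Suc k) \<omega>')))
      \<le> ereal (min b (sqdist_dilate K k (S \<omega>)) + c)" for \<omega>
  proof -
    have "continuous_on UNIV (\<lambda>x. \<phi> (V \<omega>, x))"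
      unfolding \<phi>_def
      by (auto intro!: continuous_intros continuous_on_compose2[OF continuous_on_sqdist_dilate])
    moreover have "bounded (range (\<lambda>x. \<phi> (V \<omega>, x)))"
      using bounded[of "range (Pair (V \<omega>))"] by (simp add: image_image)
    ultimately have eq: "sublin P \<Theta> (\<lambda>\<omega>'. ereal (\<phi> (V \<omega>, X (Suc k) \<omega>')))
        = sublin P \<Theta> (\<lambda>\<omega>'. ereal (\<phi> (V \<omega>, X 1 \<omega>')))"
      using ident unfolding sublin_ident_distr_def by blast
    have "sublin P \<Theta> (\<lambda>\<omega>'. ereal (\<phi> (V \<omega>, X 1 \<omega>')))
        \<le> sublin P \<Theta> (\<lambda>\<omega>'. ereal (sqdist_dilate K (Suc k) (S \<omega> + X 1 \<omega>')))"
      using \<phi>_range by (intro sublin_mono) (auto simp: \<phi>_def sumV sqdist_dilate_nonneg simp del: One_nat_def)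
    also have "\<dots> \<le> ereal (sqdist_dilate K k (S \<omega>) + c)" by (rule step)
    finally have 1: "sublin P \<Theta> (\<lambda>\<omega>'. ereal (\<phi> (V \<omega>, X 1 \<omega>')))
        \<le> ereal (sqdist_dilate K k (S \<omega>) + c)" .
    have "(\<integral>\<^sup>+ \<omega>'. ennreal (\<phi> (V \<omega>, X 1 \<omega>')) \<partial>P \<theta>) \<le> ennreal b" if "\<theta> \<in> \<Theta>" for \<theta>
    proof -
      interpret prob_space "P \<theta>" using that prob by blast
      have "(\<integral>\<^sup>+ \<omega>'. ennreal (\<phi> (V \<omega>, X 1 \<omega>')) \<partial>P \<theta>) \<le> (\<integral>\<^sup>+ \<omega>'. ennreal b \<partial>P \<theta>)"
        using \<phi>_range by (intro nn_integral_mono ennreal_leI)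
      then show ?thesis by (simp add: emeasure_space_1)
    qed
    then have 2: "sublin P \<Theta> (\<lambda>\<omega>'. ereal (\<phi> (V \<omega>, X 1 \<omega>'))) \<le> ereal b"
      using b \<phi>_range by (subst sublin_le_iff) auto
    \<comment> \<open>The bound from \<open>step\<close> and the trivial bound \<open>b\<close>
      merge into one where \<open>c\<close> stands outside the truncation; this uses
      \<open>c \<ge> 0\<close>.\<close>
    have "min (ereal (sqdist_dilate K k (S \<omega>) + c)) (ereal b)
        \<le> ereal (min b (sqdist_dilate K k (S \<omega>)) + c)"
      using c by (auto simp: min_def)
    with 1 2 show ?thesis unfolding eq by (meson min.boundedI order_trans)
  qed
  have "(\<Sum>i=1..Suc k. X i \<omega>) = S \<omega> + X (Suc k) \<omega>" for \<omega>
    by (simp add: S_def)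
  then have "sublin P \<Theta> (\<lambda>\<omega>. ereal (min b (sqdist_dilate K (Suc k) (\<Sum>i=1..Suc k. X i \<omega>))))
      = sublin P \<Theta> (\<lambda>\<omega>. ereal (\<phi> (V \<omega>, X (Suc k) \<omega>)))"
    by (simp add: \<phi>_def sumV del: One_nat_def)
  also have "\<dots> = sublin P \<Theta> (\<lambda>\<omega>. sublin P \<Theta> (\<lambda>\<omega>'. ereal (\<phi> (V \<omega>, X (Suc k) \<omega>'))))"
    using indep cont bounded unfolding sublin_indep_def by blast
  \<comment> \<open>Monotonicity requires a nonnegative inner value, which relies on \<Theta> being
    nonempty: an empty supremum would be minus infinity.\<close>
  also have "\<dots> \<le> sublin P \<Theta> (\<lambda>\<omega>. ereal (min b (sqdist_dilate K k (S \<omega>)) + c))"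
    using inner \<phi>_range(1) \<open>\<Theta> \<noteq> {}\<close> by (intro sublin_mono) (auto intro: sublin_nonneg)
  also have "\<dots> \<le> ereal (real k * c + c)"
  proof (rule sublin_add_const_le)
    fix \<theta> assume "\<theta> \<in> \<Theta>"
    then have "S \<in> borel_measurable (P \<theta>)"
      unfolding S_def using meas by (intro borel_measurable_sum) auto
    then show "(\<lambda>\<omega>. min b (sqdist_dilate K k (S \<omega>))) \<in> borel_measurable (P \<theta>)"
      by (intro borel_measurable_min borel_measurable_sqdist_dilate) auto
  next
    show "sublin P \<Theta> (\<lambda>\<omega>. ereal (min b (sqdist_dilate K k (S \<omega>)))) \<le> ereal (real k * c)"
      using Suc.IH by (simp add: S_def)
  qed (use prob b c in \<open>auto simp: sqdist_dilate_nonneg\<close>)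
  finally show ?case by (simp add: algebra_simps)
qed

section \<open>Vertex count and the final bound\<close>

text \<open>By Minkowski's theorem the polytope is the hull of its extreme points, so there is at
  least one; finiteness keeps \<open>card\<close> from its default value 0.\<close>

lemma polytope_card_extreme_points_pos:
  fixes K :: "'a::euclidean_space set"
  assumes "polytope K" "K \<noteq> {}"
  shows "0 < card {v. v extreme_point_of K}"
proof -
  have "K = convex hull {v. v extreme_point_of K}"
    using assms(1) by (intro Krein_Milman_Minkowski polytope_imp_compact polytope_imp_convex)
  then have "{v. v extreme_point_of K} \<noteq> {}"
    using assms(2) by (metis convex_hull_empty)
  then show ?thesis
    using assms(1) by (simp add: card_gt_0_iff finite_polyhedron_extreme_points polytope_imp_polyhedron)
qed

theorem theorem2p2:
  fixes M :: "'w measure"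
    and P :: "'t \<Rightarrow> 'w measure"
    and \<Theta> :: "'t set"
    and X :: "nat \<Rightarrow> 'w \<Rightarrow> 'a::euclidean_space"
    and \<P> :: "'a set"
    and m n :: nat
  assumes "\<Theta> \<noteq> {}"
    and "\<And>\<theta>. \<theta> \<in> \<Theta> \<Longrightarrow> prob_space (P \<theta>)"
    and "\<And>\<theta>. \<theta> \<in> \<Theta> \<Longrightarrow> sets (P \<theta>) = sets M"
    and "\<And>i. i \<ge> 1 \<Longrightarrow> X i \<in> borel_measurable M"
    and "\<And>\<theta>. \<theta> \<in> \<Theta> \<Longrightarrow> integrable (P \<theta>) (X 1)"
    and "sublin_iid P \<Theta> X"
    and "\<P> = convex hull (closure ((\<lambda>\<theta>. \<integral>\<omega>. X 1 \<omega> \<partial>P \<theta>) ` \<Theta>))"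
    and "polytope \<P>"
    and "card {v. v extreme_point_of \<P>} = m"
    and "n \<ge> 1"
  shows "sublin P \<Theta> (\<lambda>\<omega>. ereal ((infdist ((\<Sum>i=1..n. X i \<omega>) /\<^sub>R real n) \<P>)\<^sup>2))
    \<le> ereal (real m) *
        ((SUP \<theta>\<in>\<Theta>. expect (P \<theta>) (\<lambda>\<omega>. ereal ((norm (X 1 \<omega> - (\<integral>\<omega>'. X 1 \<omega>' \<partial>P \<theta>)))\<^sup>2)))
          + ereal ((diameter \<P>)\<^sup>2))
      / ereal (real n)"
proof -
  let ?\<mu> = "\<lambda>\<theta>. \<integral>\<omega>. X 1 \<omega> \<partial>P \<theta>"
  let ?var = "\<lambda>\<theta>. expect (P \<theta>) (\<lambda>\<omega>. ereal ((norm (X 1 \<omega> - ?\<mu> \<theta>))\<^sup>2))"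
  have prob: "prob_space (P \<theta>)" if "\<theta> \<in> \<Theta>" for \<theta>
    using assms(2) that by blast
  have meas: "X i \<in> borel_measurable (P \<theta>)" if "\<theta> \<in> \<Theta>" "i \<ge> 1" for \<theta> i
    using assms(3)[OF that(1)] assms(4)[OF that(2)] measurable_cong_sets by blast
  have mean: "?\<mu> \<theta> \<in> \<P>" if "\<theta> \<in> \<Theta>" for \<theta>
    unfolding assms(7) using that by (intro hull_inc closure_subset[THEN subsetD] imageI)
  have ne: "\<P> \<noteq> {}" using mean assms(1) by blast
  have K: "compact \<P>" "convex \<P>"
    using assms(8) by (auto simp: polytope_imp_compact polytope_imp_convex)
  have m: "m \<ge> 1" using polytope_card_extreme_points_pos[OF assms(8) ne] assms(9) by simp
  have "?var \<theta> \<ge> 0" for \<theta> by (simp add: expect_nonneg)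
  then have nonneg: "0 \<le> (SUP \<theta>\<in>\<Theta>. ?var \<theta>)"
    using assms(1) by (meson SUP_upper2 ex_in_conv)
  show ?thesis
  proof (cases "(SUP \<theta>\<in>\<Theta>. ?var \<theta>)")
    case PInf
    \<comment> \<open>As \<open>m \<ge> 1\<close>, the right-hand side is infinite; a factor 0 would
      have made the product 0.\<close>
    then show ?thesis using m assms(10) by simp
  next
    case MInf
    then show ?thesis using nonneg by simp
  next
    case (real v)
    define c where "c = v + (diameter \<P>)\<^sup>2"
    have v: "0 \<le> v" and c: "0 \<le> c" using nonneg real by (auto simp: c_def)
    have "?var \<theta> \<le> ereal v" if "\<theta> \<in> \<Theta>" for \<theta>
      using that SUP_upper[of \<theta> \<Theta> ?var] real by simp
    then have var: "(\<integral>\<^sup>+ \<omega>. ennreal ((norm (X 1 \<omega> - ?\<mu> \<theta>))\<^sup>2) \<partial>P \<theta>) \<le> ennreal v"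
      if "\<theta> \<in> \<Theta>" for \<theta>
      using that v by (simp add: expect_ennreal less_eq_ennreal.rep_eq)
    have step: "sublin P \<Theta> (\<lambda>\<omega>. ereal (sqdist_dilate \<P> (Suc k) (s + X 1 \<omega>)))
        \<le> ereal (sqdist_dilate \<P> k s + c)" for k s
      using prob_space.nn_integral_sqdist_dilate_step[OF prob K assms(5) mean var v]
      by (subst sublin_le_iff) (auto simp: c_def v sqdist_dilate_nonneg)
    have "(\<integral>\<^sup>+ \<omega>. ennreal ((infdist ((\<Sum>i=1..n. X i \<omega>) /\<^sub>R real n) \<P>)\<^sup>2) \<partial>P \<theta>)
        \<le> ennreal (c / real n)" if \<theta>: "\<theta> \<in> \<Theta>" for \<theta>
    proof -
      have S: "(\<lambda>\<omega>. \<Sum>i=1..n. X i \<omega>) \<in> borel_measurable (P \<theta>)"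
        using meas \<theta> by (intro borel_measurable_sum) auto
      note dist_meas = borel_measurable_sqdist_dilate[OF S]
      have "(\<integral>\<^sup>+ \<omega>. ennreal (min (real N) (sqdist_dilate \<P> n (\<Sum>i=1..n. X i \<omega>))) \<partial>P \<theta>)
          \<le> ennreal (real n * c)" for N :: nat
      proof -
        have "sublin P \<Theta> (\<lambda>\<omega>. ereal (min (real N) (sqdist_dilate \<P> n (\<Sum>i=1..n. X i \<omega>))))
            \<le> ereal (real n * c)"
          using prob meas c assms(10)
          by (intro sublin_truncated_sqdist_le[OF assms(1) _ _ assms(6) step ne]) auto
        then show ?thesis
          using \<theta> c by (subst (asm) sublin_le_iff) (auto simp: sqdist_dilate_nonneg)
      qed
      \<comment> \<open>The bound is uniform in the truncation level \<open>N\<close>, so the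
        truncation can be removed.\<close>
      then have *: "(\<integral>\<^sup>+ \<omega>. ennreal (sqdist_dilate \<P> n (\<Sum>i=1..n. X i \<omega>)) \<partial>P \<theta>)
          \<le> ennreal (real n * c)"
        by (rule nn_integral_le_truncated[OF dist_meas])
      have "(\<integral>\<^sup>+ \<omega>. ennreal ((infdist ((\<Sum>i=1..n. X i \<omega>) /\<^sub>R real n) \<P>)\<^sup>2) \<partial>P \<theta>)
          \<le> (\<integral>\<^sup>+ \<omega>. ennreal (1 / (real n)\<^sup>2) * ennreal (sqdist_dilate \<P> n (\<Sum>i=1..n. X i \<omega>)) \<partial>P \<theta>)"
        using infdist_mean_le_dilate[OF K(1) ne assms(10)]
        by (intro nn_integral_mono) (simp add: ennreal_mult'[symmetric] ennreal_leI)
      also have "\<dots> = ennreal (1 / (real n)\<^sup>2) *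
          (\<integral>\<^sup>+ \<omega>. ennreal (sqdist_dilate \<P> n (\<Sum>i=1..n. X i \<omega>)) \<partial>P \<theta>)"
        by (intro nn_integral_cmult measurable_compose[OF dist_meas measurable_ennreal])
      \<comment> \<open>Linear growth \<open>n * c\<close> against the scaling factor
        \<open>1/n^2\<close> leaves \<open>c/n\<close>.\<close>
      also have "\<dots> \<le> ennreal (1 / (real n)\<^sup>2) * ennreal (real n * c)"
        by (intro mult_left_mono *) auto
      also have "\<dots> = ennreal (c / real n)"
        by (simp add: ennreal_mult'[symmetric] power2_eq_square)
      finally show ?thesis .
    qed
    then have "sublin P \<Theta> (\<lambda>\<omega>. ereal ((infdist ((\<Sum>i=1..n. X i \<omega>) /\<^sub>R real n) \<P>)\<^sup>2))
        \<le> ereal (c / real n)"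
      using c by (subst sublin_le_iff) auto
    also have "\<dots> \<le> ereal (real m * c / real n)"
      using m c mult_right_mono[of 1 "real m" c] by (simp add: divide_right_mono)
    also have "\<dots> = ereal (real m) * ((SUP \<theta>\<in>\<Theta>. ?var \<theta>) + ereal ((diameter \<P>)\<^sup>2)) / ereal (real n)"
      using assms(10) unfolding real c_def by simp
    finally show ?thesis .
  qed
qed

end
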